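(* For $n\ge 1$ let $a_n = |S_n^2(231,312,321)|$. Then $a_1=1$, $a_2=4$, and $a_{n+1} = a_n + 3a_{n-1}$ for all $n\ge 2$.
   Context: A $3$-permutation of size $n$ is an ordered pair $(\sigma,\sigma')$ of permutations of $[n]=\{1,\dots,n\}$. A (classical) permutation $\tau\in S_n$ contains a pattern $\pi\in S_k$ if there are indices $c_1<\dots<c_k$ such that $\tau(c_1)\cdots\tau(c_k)$ is order-isomorphic to $\pi$, and avoids $\pi$ otherwise. A $3$-permutation $(\sigma,\sigma')$ avoids a pattern $\pi\in S_k$ if each of the three permutations $\sigma$, $\sigma'$, and $\sigma'\circ\sigma^{-1}$ (where $(\sigma'\circ\sigma^{-1})(i)=\sigma'(\sigma^{-1}(i))$) avoids $\pi$. $S_n^2(\pi_1,\dots,\pi_m)$ denotes the set of $3$-permutations of size $n$ avoiding each of $\pi_1,\dots,\pi_m$. Patterns are written in one-line notation. *)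

theory Defs
  imports "HOL-Combinatorics.Permutations"
begin

text \<open>A permutation of size \<open>n\<close> is a function \<open>\<tau>\<close> with \<open>\<tau> permutes {1..n}\<close>.
  A pattern of size \<open>k\<close> is given by its one-line notation, a list of length \<open>k\<close>;
  list positions, and hence the indices \<open>c 0 < \<dots> < c (k - 1)\<close>, are counted from \<open>0\<close>.\<close>

definition contains_pattern :: "nat \<Rightarrow> (nat \<Rightarrow> nat) \<Rightarrow> nat list \<Rightarrow> bool" where
  "contains_pattern n \<tau> p \<longleftrightarrow>
     (\<exists>c :: nat \<Rightarrow> nat. strict_mono_on {..<length p} c \<and> c ` {..<length p} \<subseteq> {1..n} \<and>
        (\<forall>i<length p. \<forall>j<length p. \<tau> (c i) < \<tau> (c j) \<longleftrightarrow> p ! i < p ! j))"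

abbreviation avoids_pattern :: "nat \<Rightarrow> (nat \<Rightarrow> nat) \<Rightarrow> nat list \<Rightarrow> bool" where
  "avoids_pattern n \<tau> p \<equiv> \<not> contains_pattern n \<tau> p"

definition three_perms :: "nat \<Rightarrow> ((nat \<Rightarrow> nat) \<times> (nat \<Rightarrow> nat)) set" where
  "three_perms n = {\<sigma>. \<sigma> permutes {1..n}} \<times> {\<sigma>'. \<sigma>' permutes {1..n}}"

definition avoids_pattern3 :: "nat \<Rightarrow> (nat \<Rightarrow> nat) \<times> (nat \<Rightarrow> nat) \<Rightarrow> nat list \<Rightarrow> bool" where
  "avoids_pattern3 n = (\<lambda>(\<sigma>, \<sigma>') p.
     avoids_pattern n \<sigma> p \<and> avoids_pattern n \<sigma>' p \<and> avoids_pattern n (\<sigma>' \<circ> inv \<sigma>) p)"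

definition avoiding_three_perms ::
    "nat \<Rightarrow> nat list set \<Rightarrow> ((nat \<Rightarrow> nat) \<times> (nat \<Rightarrow> nat)) set" where
  "avoiding_three_perms n P = {s \<in> three_perms n. \<forall>p\<in>P. avoids_pattern3 n s p}"

end

theory Submission
  imports Defs
begin

text \<open>The patterns 231, 312 and 321 are exactly those of length 3 whose first entry exceeds the last,
  so \<open>\<tau>\<close> avoids all three iff \<open>\<tau> i < \<tau> k\<close> whenever \<open>k \<ge> i + 2\<close>. Hence the maximum \<open>n + 2\<close> of such
  a \<open>\<tau>\<close> is either fixed or exchanged with \<open>n + 1\<close>. For a pair \<open>(\<sigma>, \<sigma>')\<close>, if
  one component exchanges \<open>n + 1\<close> and \<open>n + 2\<close>, the condition on \<open>\<sigma>' \<circ> inv \<sigma>\<close> forces the other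
  to exchange them too or to fix both. This gives one copy of the pairs of size \<open>n + 1\<close> and
  three copies of those of size \<open>n\<close>.\<close>

text \<open>Quantifying over all naturals, not only over \<open>{1..n}\<close>, makes the condition
  independent of the size: the same function can be read as a permutation of a larger interval that
  fixes the added points.\<close>

definition far_increasing :: "(nat \<Rightarrow> nat) \<Rightarrow> bool" where
  "far_increasing \<tau> \<longleftrightarrow> (\<forall>i k. i + 2 \<le> k \<longrightarrow> \<tau> i < \<tau> k)"

definition far_increasing_pairs :: "nat \<Rightarrow> ((nat \<Rightarrow> nat) \<times> (nat \<Rightarrow> nat)) set" where
  "far_increasing_pairs n = {(\<sigma>, \<sigma>'). \<sigma> permutes {1..n} \<and> \<sigma>' permutes {1..n} \<and>
     far_increasing \<sigma> \<and> far_increasing \<sigma>' \<and> far_increasing (\<sigma>' \<circ> inv \<sigma>)}"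

section \<open>Pattern avoidance as a comparison of non-adjacent positions\<close>

lemma contains_pattern_length3:
  "contains_pattern n \<tau> [x, y, z] \<longleftrightarrow>
     (\<exists>i j k. 1 \<le> i \<and> i < j \<and> j < k \<and> k \<le> n \<and>
        (\<tau> i < \<tau> j \<longleftrightarrow> x < y) \<and> (\<tau> j < \<tau> i \<longleftrightarrow> y < x) \<and> (\<tau> i < \<tau> k \<longleftrightarrow> x < z) \<and>
        (\<tau> k < \<tau> i \<longleftrightarrow> z < x) \<and> (\<tau> j < \<tau> k \<longleftrightarrow> y < z) \<and> (\<tau> k < \<tau> j \<longleftrightarrow> z < y))"
    (is "_ \<longleftrightarrow> ?rhs")
proof
  have set3: "{..<length [x, y, z]} = {0, 1, 2}" by auto
  { assume "contains_pattern n \<tau> [x, y, z]"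
    then obtain c where mono: "strict_mono_on {0, 1, 2} c" and range: "c ` {0, 1, 2} \<subseteq> {1..n}"
      and iso: "\<forall>i\<in>{0, 1, 2}. \<forall>j\<in>{0, 1, 2}.
        \<tau> (c i) < \<tau> (c j) \<longleftrightarrow> [x, y, z] ! i < [x, y, z] ! j"
      unfolding contains_pattern_def set3[symmetric] by auto
    have "c 0 < c 1" "c 1 < c 2" using mono by (auto simp: strict_mono_on_def)
    then show ?rhs using range iso
      by (intro exI[of _ "c 0"] exI[of _ "c 1"] exI[of _ "c 2"]) (simp add: numeral_2_eq_2) }
  assume ?rhs
  then obtain i j k where ijk: "1 \<le> i" "i < j" "j < k" "k \<le> n"
    and iso: "\<tau> i < \<tau> j \<longleftrightarrow> x < y" "\<tau> j < \<tau> i \<longleftrightarrow> y < x" "\<tau> i < \<tau> k \<longleftrightarrow> x < z"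
      "\<tau> k < \<tau> i \<longleftrightarrow> z < x" "\<tau> j < \<tau> k \<longleftrightarrow> y < z" "\<tau> k < \<tau> j \<longleftrightarrow> z < y"
    by blast
  let ?c = "\<lambda>m. [i, j, k] ! m"
  have "strict_mono_on {..<length [x, y, z]} ?c"
    unfolding set3 using ijk by (auto simp: strict_mono_on_def numeral_2_eq_2)
  moreover have "?c ` {..<length [x, y, z]} \<subseteq> {1..n}"
    unfolding set3 using ijk by (auto simp: numeral_2_eq_2)
  moreover have "\<forall>p<length [x, y, z]. \<forall>q<length [x, y, z].
      \<tau> (?c p) < \<tau> (?c q) \<longleftrightarrow> [x, y, z] ! p < [x, y, z] ! q"
    using iso by (auto simp: less_Suc_eq)
  ultimately show "contains_pattern n \<tau> [x, y, z]"
    unfolding contains_pattern_def by blast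
qed

lemma permutes_interval_le:
  fixes i n :: nat
  assumes "\<tau> permutes {1..n}" "i \<le> n"
  shows "\<tau> i \<le> n"
proof (cases "i = 0")
  case True
  then show ?thesis using permutes_not_in[OF assms(1)] by simp
next
  case False
  then show ?thesis using permutes_in_image[OF assms(1), of i] assms(2) by auto
qed

lemma permutes_interval_gt:
  fixes i n :: nat
  assumes "\<tau> permutes {1..n}" "n < i"
  shows "\<tau> i = i"
  using permutes_not_in[OF assms(1), of i] assms(2) by auto

lemma avoids_iff_far_increasing:
  assumes \<tau>: "\<tau> permutes {1..n}"
  shows "(\<forall>p\<in>{[2,3,1], [3,1,2], [3,2,1]}. avoids_pattern n \<tau> p) \<longleftrightarrow> far_increasing \<tau>"
proof
  assume avoid: "\<forall>p\<in>{[2,3,1], [3,1,2], [3,2,1]}. avoids_pattern n \<tau> p"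
  have "\<tau> i < \<tau> k" if "i + 2 \<le> k" for i k
  proof -
    \<comment> \<open>Patterns only see positions in \<open>{1..n}\<close>. The first two cases
      cover the remaining positions, where \<open>\<tau>\<close> is the identity.\<close>
    consider "n < k" | "i = 0" | "1 \<le> i" "k \<le> n" by linarith
    then show ?thesis
    proof cases
      case 1
      then show ?thesis
        using permutes_interval_le[OF \<tau>, of i] permutes_interval_gt[OF \<tau>, of i]
          permutes_interval_gt[OF \<tau>, of k] that by (cases "i \<le> n") auto
    next
      case 2
      have "\<tau> 0 = 0" using permutes_not_in[OF \<tau>] by simp
      moreover have "\<tau> k \<noteq> \<tau> 0" using that permutes_inj[OF \<tau>] by (auto dest: injD)
      ultimately show ?thesis using 2 by simp
    next
      case 3
      \<comment> \<open>The gap of 2 leaves room for a position strictly between \<open>i\<close>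
        and \<open>k\<close>. If \<open>\<tau> k < \<tau> i\<close>, then wherever
        \<open>\<tau> j\<close> lies relative to these two values, one of the three patterns occurs
        at \<open>i\<close>, \<open>j\<close>, \<open>k\<close>.\<close>
      define j where "j = i + 1"
      have j: "i < j" "j < k" using that by (auto simp: j_def)
      have "\<tau> i \<noteq> \<tau> j" "\<tau> j \<noteq> \<tau> k" "\<tau> i \<noteq> \<tau> k"
        using j permutes_inj[OF \<tau>] by (auto dest!: injD)
      moreover have "contains_pattern n \<tau> [2,3,1]" if "\<tau> k < \<tau> i" "\<tau> i < \<tau> j"
        unfolding contains_pattern_length3
        by (rule exI[of _ i], rule exI[of _ j], rule exI[of _ k]) (use that j 3 in simp)
      moreover have "contains_pattern n \<tau> [3,1,2]" if "\<tau> j < \<tau> k" "\<tau> k < \<tau> i"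
        unfolding contains_pattern_length3
        by (rule exI[of _ i], rule exI[of _ j], rule exI[of _ k]) (use that j 3 in simp)
      moreover have "contains_pattern n \<tau> [3,2,1]" if "\<tau> k < \<tau> j" "\<tau> j < \<tau> i"
        unfolding contains_pattern_length3
        by (rule exI[of _ i], rule exI[of _ j], rule exI[of _ k]) (use that j 3 in simp)
      moreover have "avoids_pattern n \<tau> [2,3,1]" "avoids_pattern n \<tau> [3,1,2]"
          "avoids_pattern n \<tau> [3,2,1]"
        using avoid by simp_all
      ultimately show ?thesis by linarith
    qed
  qed
  then show "far_increasing \<tau>" by (simp add: far_increasing_def)
next
  assume far: "far_increasing \<tau>"
  show "\<forall>p\<in>{[2,3,1], [3,1,2], [3,2,1]}. avoids_pattern n \<tau> p"
  proof (intro ballI notI)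
    fix p :: "nat list"
    assume "p \<in> {[2,3,1], [3,1,2], [3,2,1]}" "contains_pattern n \<tau> p"
    then obtain i j k where "i < j" "j < k" "\<tau> k < \<tau> i"
      by (elim insertE emptyE; clarsimp simp: contains_pattern_length3; blast)
    moreover have "\<tau> i < \<tau> k"
      using far calculation(1,2) by (simp add: far_increasing_def)
    ultimately show False by simp
  qed
qed

lemma avoiding_three_perms_eq:
  "avoiding_three_perms n {[2,3,1], [3,1,2], [3,2,1]} = far_increasing_pairs n"
proof -
  have "(\<forall>p\<in>{[2,3,1], [3,1,2], [3,2,1]}. avoids_pattern3 n (\<sigma>, \<sigma>') p) \<longleftrightarrow>
      far_increasing \<sigma> \<and> far_increasing \<sigma>' \<and> far_increasing (\<sigma>' \<circ> inv \<sigma>)"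
    if "\<sigma> permutes {1..n}" "\<sigma>' permutes {1..n}" for \<sigma> \<sigma>'
    unfolding avoids_pattern3_def prod.case
    using avoids_iff_far_increasing[OF that(1)] avoids_iff_far_increasing[OF that(2)]
      avoids_iff_far_increasing[OF permutes_compose[OF permutes_inv[OF that(1)] that(2)]]
    by blast
  then show ?thesis
    unfolding avoiding_three_perms_def three_perms_def far_increasing_pairs_def by auto
qed

section \<open>The two largest points of a single permutation\<close>

text \<open>All values at positions up to \<open>n\<close> lie below \<open>\<tau> (n + 2)\<close>,
  so the value \<open>n + 2\<close> sits at \<open>n + 1\<close> or \<open>n + 2\<close>. If it sits
  at \<open>n + 1\<close>, the value \<open>n + 1\<close> cannot sit at a position up to
  \<open>n\<close>, since that would push \<open>\<tau> (n + 2)\<close> up to \<open>n + 2\<close>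
  as well; so it sits at \<open>n + 2\<close>.\<close>

lemma far_increasing_max:
  assumes \<tau>: "\<tau> permutes {1..n + 2}" and far: "far_increasing \<tau>"
  shows "\<tau> (n + 2) = n + 2 \<or> \<tau> (n + 1) = n + 2 \<and> \<tau> (n + 2) = n + 1"
proof -
  have above: "\<tau> i < \<tau> (n + 2)" if "i \<le> n" for i
    using far that by (simp add: far_increasing_def)
  have top: "\<tau> (n + 2) \<le> n + 2" using permutes_interval_le[OF \<tau>] by blast
  obtain p where p: "\<tau> p = n + 2" using permutes_surj[OF \<tau>] by (metis surjD)
  obtain q where q: "\<tau> q = n + 1" using permutes_surj[OF \<tau>] by (metis surjD)
  have le: "p \<le> n + 2" "q \<le> n + 2"
    using permutes_interval_gt[OF \<tau>, of p] permutes_interval_gt[OF \<tau>, of q] p q by linarith+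
  have "\<not> p \<le> n" using above[of p] p top by linarith
  then have "p = n + 1 \<or> p = n + 2" using le by linarith
  moreover have "q \<le> n \<Longrightarrow> \<tau> (n + 2) = n + 2" using above[of q] q top by linarith
  moreover have "q \<noteq> p" using p q by auto
  moreover have "q \<le> n \<or> q = n + 1 \<or> q = n + 2" using le by linarith
  ultimately show ?thesis using p q by auto
qed

lemma permutes_interval_drop:
  fixes n :: nat
  assumes "\<tau> permutes {1..n + 1}" "\<tau> (n + 1) = n + 1"
  shows "\<tau> permutes {1..n}"
  using assms(1) by (rule permutes_superset) (use assms(2) in \<open>auto simp: le_Suc_eq\<close>)

lemma permutes_interval_mono:
  fixes m n :: nat
  assumes "\<tau> permutes {1..m}" "m \<le> n"
  shows "\<tau> permutes {1..n}"
  using assms by (auto intro: permutes_subset)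

lemma permutes_comp_transpose_top:
  fixes n :: nat
  assumes "\<rho> permutes {1..n}"
  shows "\<rho> \<circ> transpose (n + 1) (n + 2) permutes {1..n + 2}"
  by (intro permutes_compose permutes_swap_id permutes_interval_mono[OF assms]) auto

text \<open>Composing with the transposition turns the last two entries \<open>n + 1\<close>,
  \<open>n + 2\<close> of the one-line notation of \<open>\<rho>\<close> into \<open>n + 2\<close>,
  \<open>n + 1\<close>. Only the order of this adjacent pair changes, and
  \<open>far_increasing\<close> never compares adjacent positions.\<close>

lemma far_increasing_comp_transpose_iff:
  assumes \<rho>: "\<rho> permutes {1..n}"
  shows "far_increasing (\<rho> \<circ> transpose (n + 1) (n + 2)) \<longleftrightarrow> far_increasing \<rho>"
proof -
  let ?\<tau> = "\<rho> \<circ> transpose (n + 1) (n + 2)"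
  have same: "?\<tau> i = \<rho> i" if "i \<le> n \<or> n + 2 < i" for i
    using that by (auto simp: transpose_def)
  have swapped: "?\<tau> (n + 1) = n + 2" "?\<tau> (n + 2) = n + 1" "\<rho> (n + 1) = n + 1" "\<rho> (n + 2) = n + 2"
    using permutes_interval_gt[OF \<rho>] by simp_all
  have "?\<tau> i < ?\<tau> k \<longleftrightarrow> \<rho> i < \<rho> k" if "i + 2 \<le> k" for i k
  proof -
    consider "k \<le> n" | "n < k" "i \<le> n" | "n < i" by linarith
    then show ?thesis
    proof cases
      case 1
      then show ?thesis using same[of i] same[of k] that by simp
    next
      case 2
      have "\<rho> i \<le> n" using permutes_interval_le[OF \<rho> 2(2)] .
      moreover have "n < ?\<tau> k" "n < \<rho> k"
      proof -
        consider "k = n + 1" | "k = n + 2" | "n + 2 < k" using 2 by linarith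
        then show "n < ?\<tau> k" "n < \<rho> k"
          using same[of k] swapped permutes_interval_gt[OF \<rho>, of k] by (cases; simp)+
      qed
      ultimately show ?thesis using same[of i] 2 by linarith
    next
      case 3
      \<comment> \<open>From \<open>n < i\<close> and \<open>i + 2 \<le> k\<close> it follows that
        \<open>n + 3 \<le> k\<close>, so \<open>k\<close> lies beyond both transposed
        points.\<close>
      then have "\<rho> i = i" "\<rho> k = k" "?\<tau> k = k"
        using that permutes_interval_gt[OF \<rho>] same[of k] by auto
      moreover have "?\<tau> i < k"
      proof -
        consider "i = n + 1" | "i = n + 2" | "n + 2 < i" using 3 by linarith
        then show ?thesis
          using same[of i] swapped \<open>\<rho> i = i\<close> that by cases auto
      qed
      ultimately show ?thesis using that by simp
    qed
  qed
  then show ?thesis by (auto simp: far_increasing_def)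
qed

lemma far_increasing_cases:
  assumes \<tau>: "\<tau> permutes {1..n + 2}" and far: "far_increasing \<tau>"
  obtains (fixed) "\<tau> permutes {1..n + 1}"
  | (swapped) \<rho> where "\<rho> permutes {1..n}" "\<tau> = \<rho> \<circ> transpose (n + 1) (n + 2)"
proof -
  let ?t = "transpose (n + 1) (n + 2)"
  from far_increasing_max[OF assms] show ?thesis
  proof
    assume "\<tau> (n + 2) = n + 2"
    then show ?thesis using permutes_interval_drop[of \<tau> "n + 1"] \<tau> fixed by simp
  next
    assume top: "\<tau> (n + 1) = n + 2 \<and> \<tau> (n + 2) = n + 1"
    have "\<tau> \<circ> ?t permutes {1..n + 2}"
      by (intro permutes_compose permutes_swap_id \<tau>) auto
    \<comment> \<open>Undoing the exchange makes \<open>n + 2\<close> and \<open>n + 1\<close> fixed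
      points, which are dropped one after the other.\<close>
    then have "\<tau> \<circ> ?t permutes {1..n + 1}"
      using permutes_interval_drop[of "\<tau> \<circ> ?t" "n + 1"] top by simp
    then have "\<tau> \<circ> ?t permutes {1..n}"
      using permutes_interval_drop[of "\<tau> \<circ> ?t" n] top by simp
    moreover have "\<tau> = (\<tau> \<circ> ?t) \<circ> ?t" by (simp add: fun_eq_iff)
    ultimately show ?thesis by (rule swapped)
  qed
qed

section \<open>The quotient \<open>\<sigma>' \<circ> inv \<sigma>\<close> under exchanges of the top
  points\<close>

lemma inv_comp_transpose:
  assumes "\<rho> permutes S"
  shows "inv (\<rho> \<circ> transpose a b) = transpose a b \<circ> inv \<rho>"
  using o_inv_distrib[OF permutes_bij[OF assms] bij_transpose[of a b]] by simp

text \<open>The supports are disjoint: \<open>\<rho>\<close> fixes both transposed points, so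
  conjugating the transposition by it changes nothing.\<close>

lemma transpose_top_comp_inv:
  fixes n :: nat
  assumes "\<rho> permutes {1..n}"
  shows "transpose (n + 1) (n + 2) \<circ> inv \<rho> = inv \<rho> \<circ> transpose (n + 1) (n + 2)"
  using transpose_comp_eq[OF permutes_bij[OF permutes_inv[OF assms]], of "n + 1" "n + 2"]
  by (simp add: permutes_inv_inv[OF assms] permutes_interval_gt[OF assms])

text \<open>Two exchanges cancel in the quotient. A single one survives and can be moved to the
  right end by commutation, where \<open>far_increasing_comp_transpose_iff\<close> removes
  it.\<close>

lemma ratio_comp_transpose_top:
  fixes n :: nat
  defines "t \<equiv> transpose (n + 1) (n + 2)"
  assumes \<sigma>: "\<sigma> permutes {1..n}"
  shows "(\<sigma>' \<circ> t) \<circ> inv (\<sigma> \<circ> t) = \<sigma>' \<circ> inv \<sigma>"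
    and "(\<sigma>' \<circ> t) \<circ> inv \<sigma> = (\<sigma>' \<circ> inv \<sigma>) \<circ> t"
    and "\<sigma>' \<circ> inv (\<sigma> \<circ> t) = (\<sigma>' \<circ> inv \<sigma>) \<circ> t"
  using inv_comp_transpose[OF \<sigma>, of "n + 1" "n + 2"] transpose_top_comp_inv[OF \<sigma>]
  unfolding t_def by (simp_all add: comp_assoc) (simp add: fun_eq_iff)

text \<open>If \<open>\<sigma>\<close> exchanges the two largest points and \<open>\<sigma>'\<close> fixes the largest, then \<open>\<sigma>' \<circ> inv \<sigma>\<close> moves
  \<open>n + 1\<close> to \<open>n + 2\<close>, so it must exchange them, which forces \<open>\<sigma>'\<close> to fix \<open>n + 1\<close>.\<close>

lemma ratio_left_swapped:
  fixes n :: nat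
  assumes \<rho>: "\<rho> permutes {1..n}" and \<sigma>': "\<sigma>' permutes {1..n + 1}"
    and far: "far_increasing (\<sigma>' \<circ> inv (\<rho> \<circ> transpose (n + 1) (n + 2)))"
  shows "\<sigma>' permutes {1..n}"
proof -
  let ?\<pi> = "\<sigma>' \<circ> inv (\<rho> \<circ> transpose (n + 1) (n + 2))"
  have \<sigma>'2: "\<sigma>' permutes {1..n + 2}" using permutes_interval_mono[OF \<sigma>'] by simp
  have "?\<pi> permutes {1..n + 2}"
    by (intro permutes_compose permutes_inv permutes_comp_transpose_top \<rho> \<sigma>'2)
  note max = far_increasing_max[OF this far]
  \<comment> \<open>This value is at most \<open>n + 1\<close>, which rules out that
    \<open>?\<pi>\<close> fixes \<open>n + 2\<close>; the other alternative in \<open>max\<close>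
    gives its exact value.\<close>
  have "?\<pi> (n + 2) = \<sigma>' (n + 1)"
    using permutes_interval_gt[OF permutes_inv[OF \<rho>]] inv_comp_transpose[OF \<rho>] by simp
  moreover have "\<sigma>' (n + 1) \<le> n + 1" using permutes_interval_le[OF \<sigma>'] by blast
  ultimately have "\<sigma>' (n + 1) = n + 1" using max by auto
  then show ?thesis using permutes_interval_drop[OF \<sigma>'] by blast
qed

text \<open>The mirror case: the quotient sends \<open>n + 2\<close> to \<open>n + 1\<close>, hence
  must send \<open>n + 1\<close> to \<open>n + 2\<close>. But it also sends
  \<open>\<sigma> (n + 1)\<close> to \<open>n + 2\<close>, so injectivity makes \<open>n + 1\<close>
  a fixed point of \<open>\<sigma>\<close>.\<close>

lemma ratio_right_swapped:
  fixes n :: nat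
  assumes \<rho>': "\<rho>' permutes {1..n}" and \<sigma>: "\<sigma> permutes {1..n + 1}"
    and far: "far_increasing ((\<rho>' \<circ> transpose (n + 1) (n + 2)) \<circ> inv \<sigma>)"
  shows "\<sigma> permutes {1..n}"
proof -
  let ?\<pi> = "(\<rho>' \<circ> transpose (n + 1) (n + 2)) \<circ> inv \<sigma>"
  have \<sigma>2: "\<sigma> permutes {1..n + 2}" using permutes_interval_mono[OF \<sigma>] by simp
  have \<pi>: "?\<pi> permutes {1..n + 2}"
    by (intro permutes_compose permutes_inv permutes_comp_transpose_top \<rho>' \<sigma>2)
  have "?\<pi> (n + 2) = n + 1"
    using permutes_interval_gt[OF permutes_inv[OF \<sigma>], of "n + 2"] permutes_interval_gt[OF \<rho>']
    by simp
  then have "?\<pi> (n + 1) = n + 2" using far_increasing_max[OF \<pi> far] by simp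
  moreover have "?\<pi> (\<sigma> (n + 1)) = n + 2"
    using permutes_inverses(2)[OF \<sigma>] permutes_interval_gt[OF \<rho>'] by simp
  ultimately have "\<sigma> (n + 1) = n + 1" using permutes_inj[OF \<pi>] by (metis injD)
  then show ?thesis using permutes_interval_drop[OF \<sigma>] by blast
qed

section \<open>Decomposition of the pairs and the recurrence\<close>

text \<open>The four pieces correspond to which components exchange \<open>n + 1\<close> and
  \<open>n + 2\<close>: neither, only the first, only the second, or both. If at least one does,
  stripping the exchanges leaves a pair of size \<open>n\<close>, since in the mixed cases the other
  component is forced to fix both points.\<close>

lemma far_increasing_pairs_Suc_Suc:
  fixes n :: nat
  defines "ext \<equiv> \<lambda>\<rho>. \<rho> \<circ> transpose (n + 1) (n + 2)"
  shows "far_increasing_pairs (n + 2) = far_increasing_pairs (n + 1) \<union>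
    (map_prod ext id ` far_increasing_pairs n \<union> (map_prod id ext ` far_increasing_pairs n \<union>
    map_prod ext ext ` far_increasing_pairs n))" (is "_ = ?R")
proof (intro equalityI subrelI)
  fix \<sigma> \<sigma>' assume "(\<sigma>, \<sigma>') \<in> far_increasing_pairs (n + 2)"
  then have perm: "\<sigma> permutes {1..n + 2}" "\<sigma>' permutes {1..n + 2}"
    and far: "far_increasing \<sigma>" "far_increasing \<sigma>'" "far_increasing (\<sigma>' \<circ> inv \<sigma>)"
    by (auto simp: far_increasing_pairs_def)
  note iff = far_increasing_comp_transpose_iff
  from perm(1) far(1) show "(\<sigma>, \<sigma>') \<in> ?R"
  proof (cases rule: far_increasing_cases)
    case \<sigma>: fixed
    from perm(2) far(2) show ?thesis
    proof (cases rule: far_increasing_cases)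
      case fixed
      then show ?thesis using \<sigma> far by (simp add: far_increasing_pairs_def)
    next
      case (swapped \<rho>')
      \<comment> \<open>The commutation behind \<open>ratio_comp_transpose_top\<close> requires
        \<open>\<sigma>\<close> to fix \<open>n + 1\<close> too, so this comes before the quotient
        is rewritten.\<close>
      have \<sigma>n: "\<sigma> permutes {1..n}"
        using ratio_right_swapped[OF swapped(1) \<sigma>] far(3) swapped(2) by simp
      have "far_increasing (\<rho>' \<circ> inv \<sigma>)"
        using far(3) unfolding swapped(2) ratio_comp_transpose_top(2)[OF \<sigma>n]
          iff[OF permutes_compose[OF permutes_inv[OF \<sigma>n] swapped(1)]] .
      moreover have "far_increasing \<rho>'" using far(2) unfolding swapped(2) iff[OF swapped(1)] .
      ultimately have "(\<sigma>, \<rho>') \<in> far_increasing_pairs n"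
        using \<sigma>n swapped far by (simp add: far_increasing_pairs_def)
      then have "map_prod id ext (\<sigma>, \<rho>') \<in> map_prod id ext ` far_increasing_pairs n"
        by (rule imageI)
      then show ?thesis using swapped(2) by (simp add: ext_def)
    qed
  next
    case \<sigma>: (swapped \<rho>)
    have \<rho>: "far_increasing \<rho>" using far(1) unfolding \<sigma>(2) iff[OF \<sigma>(1)] .
    from perm(2) far(2) show ?thesis
    proof (cases rule: far_increasing_cases)
      case fixed
      have \<sigma>'n: "\<sigma>' permutes {1..n}"
        using ratio_left_swapped[OF \<sigma>(1) fixed] far(3) \<sigma>(2) by simp
      have "far_increasing (\<sigma>' \<circ> inv \<rho>)"
        using far(3) unfolding \<sigma>(2) ratio_comp_transpose_top(3)[OF \<sigma>(1)]
          iff[OF permutes_compose[OF permutes_inv[OF \<sigma>(1)] \<sigma>'n]] .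
      then have "(\<rho>, \<sigma>') \<in> far_increasing_pairs n"
        using \<sigma>'n \<sigma> \<rho> far by (simp add: far_increasing_pairs_def)
      then have "map_prod ext id (\<rho>, \<sigma>') \<in> map_prod ext id ` far_increasing_pairs n"
        by (rule imageI)
      then show ?thesis using \<sigma>(2) by (simp add: ext_def)
    next
      case (swapped \<rho>')
      have "far_increasing (\<rho>' \<circ> inv \<rho>)"
        using far(3) unfolding \<sigma>(2) swapped(2) ratio_comp_transpose_top(1)[OF \<sigma>(1)] .
      moreover have "far_increasing \<rho>'" using far(2) unfolding swapped(2) iff[OF swapped(1)] .
      ultimately have "(\<rho>, \<rho>') \<in> far_increasing_pairs n"
        using \<sigma>(1) swapped(1) \<rho> by (simp add: far_increasing_pairs_def)
      then have "map_prod ext ext (\<rho>, \<rho>') \<in> map_prod ext ext ` far_increasing_pairs n"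
        by (rule imageI)
      then show ?thesis using \<sigma>(2) swapped(2) by (simp add: ext_def)
    qed
  qed
next
  fix \<sigma> \<sigma>' assume "(\<sigma>, \<sigma>') \<in> ?R"
  moreover have "(\<sigma>, \<sigma>') \<in> far_increasing_pairs (n + 2)"
    if "(\<sigma>, \<sigma>') \<in> far_increasing_pairs (n + 1)"
    using that permutes_interval_mono[of _ "n + 1" "n + 2"] by (auto simp: far_increasing_pairs_def)
  moreover have "map_prod ext id (\<rho>, \<rho>') \<in> far_increasing_pairs (n + 2)"
      "map_prod id ext (\<rho>, \<rho>') \<in> far_increasing_pairs (n + 2)"
      "map_prod ext ext (\<rho>, \<rho>') \<in> far_increasing_pairs (n + 2)"
    if "(\<rho>, \<rho>') \<in> far_increasing_pairs n" for \<rho> \<rho>'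
  proof -
    have \<rho>: "\<rho> permutes {1..n}" "\<rho>' permutes {1..n}"
      using that by (simp_all add: far_increasing_pairs_def)
    \<comment> \<open>The quotient is itself a permutation of size \<open>n\<close>, so a surviving
      exchange can be stripped from it just as from the two components.\<close>
    have "\<rho>' \<circ> inv \<rho> permutes {1..n}" using \<rho> by (intro permutes_compose permutes_inv)
    note iff = this[THEN far_increasing_comp_transpose_iff] \<rho>[THEN far_increasing_comp_transpose_iff]
    note perm = \<rho>[THEN permutes_comp_transpose_top] permutes_interval_mono[OF \<rho>(1), of "n + 2"]
      permutes_interval_mono[OF \<rho>(2), of "n + 2"]
    show "map_prod ext id (\<rho>, \<rho>') \<in> far_increasing_pairs (n + 2)"
      "map_prod id ext (\<rho>, \<rho>') \<in> far_increasing_pairs (n + 2)"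
      "map_prod ext ext (\<rho>, \<rho>') \<in> far_increasing_pairs (n + 2)"
      using that perm unfolding far_increasing_pairs_def map_prod_simp ext_def id_apply
        mem_Collect_eq prod.case ratio_comp_transpose_top[OF \<rho>(1)] iff
      by (simp_all add: comp_assoc)
  qed
  ultimately show "(\<sigma>, \<sigma>') \<in> far_increasing_pairs (n + 2)" by auto
qed

lemma finite_far_increasing_pairs: "finite (far_increasing_pairs n)"
  by (rule finite_subset[of _ "{\<sigma>. \<sigma> permutes {1..n}} \<times> {\<sigma>. \<sigma> permutes {1..n}}"])
    (auto simp: far_increasing_pairs_def finite_permutations)

text \<open>The pieces of the decomposition are disjoint because the values of both components at
  \<open>n + 2\<close>, collected in \<open>?top\<close>, take a different constant pair on each
  piece.\<close>

lemma card_far_increasing_pairs_Suc_Suc: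
  "card (far_increasing_pairs (n + 2)) =
    card (far_increasing_pairs (n + 1)) + 3 * card (far_increasing_pairs n)"
proof -
  define ext :: "(nat \<Rightarrow> nat) \<Rightarrow> nat \<Rightarrow> nat" where "ext = (\<lambda>\<rho>. \<rho> \<circ> transpose (n + 1) (n + 2))"
  let ?A = far_increasing_pairs and ?top = "\<lambda>(\<sigma>, \<sigma>'). (\<sigma> (n + 2), \<sigma>' (n + 2))"
  have "inj ext"
    \<comment> \<open>Composition with a transposition is an involution, so \<open>ext\<close> is
      its own left inverse.\<close>
    by (rule inj_on_inverseI[of _ ext]) (simp add: ext_def comp_assoc)
  then have inj: "inj_on (map_prod ext id) (?A n)" "inj_on (map_prod id ext) (?A n)"
      "inj_on (map_prod ext ext) (?A n)"
    by (auto simp: inj_on_def)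
  have top: "?top s = (n + 2, n + 2)" if "s \<in> ?A (n + 1)" for s
    using that permutes_interval_gt[of _ "n + 1" "n + 2"] by (auto simp: far_increasing_pairs_def)
  have ext: "?top (map_prod ext id s) = (n + 1, n + 2)" "?top (map_prod id ext s) = (n + 2, n + 1)"
      "?top (map_prod ext ext s) = (n + 1, n + 1)" if "s \<in> ?A n" for s
    using that permutes_interval_gt[of _ n "n + 1"] permutes_interval_gt[of _ n "n + 2"]
    by (auto simp: far_increasing_pairs_def ext_def)
  have "?A (n + 1) \<inter> (map_prod ext id ` ?A n \<union> (map_prod id ext ` ?A n \<union> map_prod ext ext ` ?A n)) = {}"
    using top ext by fastforce
  moreover have "map_prod ext id ` ?A n \<inter> (map_prod id ext ` ?A n \<union> map_prod ext ext ` ?A n) = {}"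
    using ext by fastforce
  moreover have "map_prod id ext ` ?A n \<inter> map_prod ext ext ` ?A n = {}"
    using ext by fastforce
  ultimately show ?thesis
    unfolding far_increasing_pairs_Suc_Suc ext_def[symmetric]
    by (simp add: card_Un_disjoint finite_far_increasing_pairs card_image inj)
qed

text \<open>Size 0 is included as a starting value: with size 1 it determines the count at size 2
  through the recurrence.\<close>

lemma far_increasing_pairs_le_1:
  assumes "n \<le> 1"
  shows "far_increasing_pairs n = {(id, id)}"
proof -
  have "\<sigma> permutes {1..n} \<longleftrightarrow> \<sigma> = id" for \<sigma>
    using assms by (cases n) auto
  then show ?thesis
    by (auto simp: far_increasing_pairs_def far_increasing_def)
qed

theorem theorem4p5:
  fixes a :: "nat \<Rightarrow> nat"
  assumes a: "\<And>n. n \<ge> 1 \<Longrightarrow> a n = card (avoiding_three_perms n {[2,3,1], [3,1,2], [3,2,1]})"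
  shows "a 1 = 1 \<and> a 2 = 4 \<and> (\<forall>n\<ge>2. a (n + 1) = a n + 3 * a (n - 1))"
proof (intro conjI allI impI)
  have a_eq: "a n = card (far_increasing_pairs n)" if "n \<ge> 1" for n
    using a[OF that] unfolding avoiding_three_perms_eq .
  show "a 1 = 1"
    by (simp add: a_eq far_increasing_pairs_le_1)
  show "a 2 = 4"
    \<comment> \<open>The recurrence at index 0 reads \<open>1 + 3 * 1 = 4\<close>.\<close>
    using card_far_increasing_pairs_Suc_Suc[of 0] unfolding add_0
    by (simp add: a_eq far_increasing_pairs_le_1)
  fix n :: nat assume "n \<ge> 2"
  \<comment> \<open>The sizes are \<open>n - 1\<close>, \<open>n\<close> and \<open>n + 1\<close>;
    \<open>n \<ge> 2\<close> keeps the smallest at least 1, where \<open>a\<close> is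
    specified.\<close>
  then show "a (n + 1) = a n + 3 * a (n - 1)"
    using card_far_increasing_pairs_Suc_Suc[of "n - 1"] by (simp add: a_eq)
qed

end
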